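(* If $P$ is a polyomino of minimum size among polyominoes which contain $27$ instances of the L tromino, then $34\le |P|\le 35$.
   Context: Cells are the unit squares of the square lattice, indexed by integer coordinates $(x,y)$. A polyomino is a finite nonempty edge-connected set of cells; its size $|P|$ is its number of cells. The L tromino is $\{(0,0),(1,0),(0,1)\}$ (only this orientation); an instance is a translate of it, and an instance in $P$ is one contained in $P$. "Contains $27$ instances" means contains at least $27$ distinct instances. *)

theory Defs
  imports Main
begin

type_synonym cell = "int \<times> int"

definition edge_adjacent :: "cell \<Rightarrow> cell \<Rightarrow> bool" where
  "edge_adjacent c d \<longleftrightarrow> \<bar>fst c - fst d\<bar> + \<bar>snd c - snd d\<bar> = 1"

definition edge_connected :: "cell set \<Rightarrow> bool" where
  "edge_connected P \<longleftrightarrow>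
    (\<forall>c\<in>P. \<forall>d\<in>P. (c, d) \<in> {(a, b). a \<in> P \<and> b \<in> P \<and> edge_adjacent a b}\<^sup>*)"

definition polyomino :: "cell set \<Rightarrow> bool" where
  "polyomino P \<longleftrightarrow> finite P \<and> P \<noteq> {} \<and> edge_connected P"

definition translate :: "cell \<Rightarrow> cell set \<Rightarrow> cell set" where
  "translate v A = (\<lambda>(x, y). (x + fst v, y + snd v)) ` A"

definition L_tromino :: "cell set" where
  "L_tromino = {(0, 0), (1, 0), (0, 1)}"

definition instances_in :: "cell set \<Rightarrow> cell set \<Rightarrow> cell set set" where
  "instances_in A P = {T. (\<exists>v. T = translate v A) \<and> T \<subseteq> P}"

text \<open>For finite \<open>P\<close> and nonempty \<open>A\<close> the set \<open>instances_in A P\<close> is finite, so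
  \<open>card\<close> is the true number of instances.\<close>

definition contains_instances :: "nat \<Rightarrow> cell set \<Rightarrow> cell set \<Rightarrow> bool" where
  "contains_instances n A P \<longleftrightarrow> n \<le> card (instances_in A P)"

definition minimum_polyomino :: "nat \<Rightarrow> cell set \<Rightarrow> cell set \<Rightarrow> bool" where
  "minimum_polyomino n A P \<longleftrightarrow>
    polyomino P \<and> contains_instances n A P \<and>
    (\<forall>Q. polyomino Q \<and> contains_instances n A Q \<longrightarrow> card P \<le> card Q)"

end

theory Submission
  imports Defs
begin

text \<open>An instance is determined by its corner. Let \<open>A\<close> be the set of corners of the instances in \<open>P\<close>
  and fix a row \<open>m\<close>. The part of \<open>A\<close> in rows at most \<open>m\<close>, together with its translate by \<open>(1, 0)\<close>,
  gains at least one cell per nonempty row, and the part in rows at least \<open>m\<close>, translated by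
  \<open>(0, 1)\<close>, lies strictly above; row \<open>m\<close> is counted twice. So \<open>P\<close> has at least
  \<open>|A| + r + a\<close> cells, where \<open>r\<close> is the number of nonempty rows of \<open>A\<close> up to \<open>m\<close> and \<open>a\<close> the
  number of elements of \<open>A\<close> in row \<open>m\<close>. If \<open>A\<close> has six nonempty rows, take \<open>m\<close> to be the topmost one; otherwise
  \<open>|A| \<ge> 27\<close> forces a row with six elements. Either way \<open>|P| \<ge> 27 + 7\<close>. For the upper bound,
  remove one acute corner from the triangle with \<open>36\<close> cells and \<open>28\<close> instances.\<close>

definition corners :: "cell set \<Rightarrow> cell set" where
  "corners P = {(x, y). (x, y) \<in> P \<and> (x + 1, y) \<in> P \<and> (x, y + 1) \<in> P}"

lemma corners_subset: "corners P \<subseteq> P"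
  by (auto simp: corners_def)

lemma translate_L_tromino:
  "translate (x, y) L_tromino = {(x, y), (x + 1, y), (x, y + 1)}"
  by (auto simp: translate_def L_tromino_def)

lemma inj_translate_L_tromino: "inj (\<lambda>v. translate v L_tromino)"
  by (auto simp: inj_def translate_L_tromino set_eq_subset)

lemma instances_in_L_tromino:
  "instances_in L_tromino P = (\<lambda>v. translate v L_tromino) ` corners P"
proof -
  have "translate v L_tromino \<subseteq> P \<longleftrightarrow> v \<in> corners P" for v
    by (cases v) (auto simp: corners_def translate_L_tromino)
  then show ?thesis
    by (auto simp: instances_in_def)
qed

lemma card_instances_in_L_tromino: "card (instances_in L_tromino P) = card (corners P)"
  unfolding instances_in_L_tromino
  by (rule card_image) (rule inj_on_subset[OF inj_translate_L_tromino subset_UNIV])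

text \<open>The cell just right of the rightmost cell of a row lies in the shifted copy but not in
  \<open>B\<close>, and different rows give different such cells.\<close>

lemma card_union_shift_right:
  fixes B :: "cell set"
  assumes "finite B"
  shows "card B + card (snd ` B) \<le> card (B \<union> (\<lambda>(x, y). (x + 1, y)) ` B)"
proof -
  define e where "e y = Max {x. (x, y) \<in> B}" for y
  define R where "R = (\<lambda>y. (e y + 1, y)) ` (snd ` B)"
  have fin: "finite {x. (x, y) \<in> B}" for y
    by (rule finite_subset[of _ "fst ` B"]) (auto simp: assms image_iff, force)
  have e_in: "(e y, y) \<in> B" if "y \<in> snd ` B" for y
    using Max_in[OF fin, of y] that by (fastforce simp: e_def)
  have e_ge: "x \<le> e y" if "(x, y) \<in> B" for x y
    using that fin by (auto simp: e_def)
  have "card R = card (snd ` B)"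
    unfolding R_def by (rule card_image) (auto simp: inj_on_def)
  moreover have "B \<inter> R = {}"
    using e_ge by (force simp: R_def)
  moreover have "R \<subseteq> (\<lambda>(x, y). (x + 1, y)) ` B"
    using e_in by (force simp: R_def)
  moreover have "finite R"
    using assms by (simp add: R_def)
  ultimately have "card B + card (snd ` B) = card (B \<union> R)"
    using assms by (simp add: card_Un_disjoint)
  also have "\<dots> \<le> card (B \<union> (\<lambda>(x, y). (x + 1, y)) ` B)"
    using assms \<open>R \<subseteq> _\<close> by (intro card_mono) auto
  finally show ?thesis .
qed

lemma card_ge_corners:
  fixes m :: int
  assumes "finite P"
  defines "A \<equiv> corners P"
  shows "card A + card {y \<in> snd ` A. y \<le> m} + card {c \<in> A. snd c = m} \<le> card P"
proof -
  define B where "B = {c \<in> A. snd c \<le> m}"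
  define C where "C = {c \<in> A. m \<le> snd c}"
  let ?U = "B \<union> (\<lambda>(x, y). (x + 1, y)) ` B"
  let ?V = "(\<lambda>(x, y). (x, y + 1)) ` C"
  have "finite A"
    using assms finite_subset[OF corners_subset] by blast
  then have fin: "finite B" "finite C"
    by (auto simp: B_def C_def)
  have "card B + card C = card (B \<union> C) + card (B \<inter> C)"
    using fin by (rule card_Un_Int)
  moreover have "B \<union> C = A" "B \<inter> C = {c \<in> A. snd c = m}"
    by (auto simp: B_def C_def)
  moreover have "snd ` B = {y \<in> snd ` A. y \<le> m}"
    by (auto simp: B_def)
  moreover have "card B + card (snd ` B) \<le> card ?U"
    using fin(1) by (rule card_union_shift_right)
  moreover have "card ?V = card C"
    by (rule card_image) (auto simp: inj_on_def)
  moreover have "card ?U + card ?V = card (?U \<union> ?V)"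
    using fin by (intro card_Un_disjoint[symmetric]) (auto simp: B_def C_def)
  \<comment> \<open>A corner and its right and upper neighbours all belong to
    \<open>P\<close>.\<close>
  moreover have "card (?U \<union> ?V) \<le> card P"
    using assms(1) by (rule card_mono) (auto simp: A_def B_def C_def corners_def)
  ultimately show ?thesis
    by simp
qed

lemma card_ge_34:
  assumes "finite P" "27 \<le> card (corners P)"
  shows "34 \<le> card P"
proof -
  let ?A = "corners P"
  let ?R = "snd ` ?A"
  have fin: "finite ?A"
    using assms(1) finite_subset[OF corners_subset] by blast
  have "?A \<noteq> {}"
    using assms(2) by auto
  have row: "1 \<le> card {c \<in> ?A. snd c = m}" if "m \<in> ?R" for m
    using that fin by (auto simp: Suc_le_eq card_gt_0_iff)
  show ?thesis
  proof (cases "6 \<le> card ?R")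
    case True
    define m where "m = Max ?R"
    have "m \<in> ?R"
      unfolding m_def using fin \<open>?A \<noteq> {}\<close> by (intro Max_in) auto
    moreover have "{y \<in> ?R. y \<le> m} = ?R"
      unfolding m_def using fin by (blast intro: Max_ge finite_imageI)
    ultimately show ?thesis
      using card_ge_corners[OF assms(1), of m] row[of m] True assms(2) by simp
  next
    case False
    \<comment> \<open>At most five rows with at most five corners each would hold at most 25 < 27
      corners.\<close>
    have "\<exists>m\<in>?R. 6 \<le> card {c \<in> ?A. snd c = m}"
    proof (rule ccontr)
      assume "\<not> ?thesis"
      then have small: "card {c \<in> ?A. snd c = m} \<le> 5" if "m \<in> ?R" for m
        using that by force
      have "card ?A = (\<Sum>m\<in>?R. card {c \<in> ?A. snd c = m})"
        using fin by (subst card_eq_sum, subst sum.image_gen[of _ _ snd]) auto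
      also have "\<dots> \<le> of_nat (card ?R) * 5"
        by (rule sum_bounded_above) (rule small)
      finally show False
        using False assms(2) by simp
    qed
    then obtain m where m: "m \<in> ?R" "6 \<le> card {c \<in> ?A. snd c = m}"
      by blast
    have "{y \<in> ?R. y \<le> m} \<noteq> {}"
      using m(1) by blast
    then have "1 \<le> card {y \<in> ?R. y \<le> m}"
      using fin by (simp add: Suc_le_eq card_gt_0_iff)
    then show ?thesis
      using card_ge_corners[OF assms(1), of m] m(2) assms(2) by simp
  qed
qed

text \<open>The triangle \<open>x, y \<ge> 0\<close>, \<open>x + y \<le> 7\<close> without
  \<open>(7, 0)\<close>, written by columns so that cardinalities become short sums.\<close>

definition truncated_triangle :: "cell set" where
  "truncated_triangle = Sigma {0..6} (\<lambda>x. {0..7 - x})"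

lemma card_truncated_triangle: "card truncated_triangle = 35"
proof -
  have "{0..6} = {0, 1, 2, 3, 4, 5, 6 :: int}"
    by auto
  then show ?thesis
    by (simp add: truncated_triangle_def)
qed

lemma card_corners_truncated_triangle: "card (corners truncated_triangle) = 27"
proof -
  \<comment> \<open>Deleting \<open>(7, 0)\<close> costs the full triangle only the corner
    \<open>(6, 0)\<close>.\<close>
  have "corners truncated_triangle = Sigma {0..5} (\<lambda>x. {0..6 - x})"
    by (auto simp: corners_def truncated_triangle_def)
  moreover have "{0..5} = {0, 1, 2, 3, 4, 5 :: int}"
    by auto
  ultimately show ?thesis
    by simp
qed

lemma polyomino_truncated_triangle: "polyomino truncated_triangle"
proof -
  let ?T = truncated_triangle
  let ?E = "{(a, b). a \<in> ?T \<and> b \<in> ?T \<and> edge_adjacent a b}"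
  \<comment> \<open>Walk down to the bottom row, then left; each step lowers the coordinate sum by
    one.\<close>
  have to_origin: "(c, (0, 0)) \<in> ?E\<^sup>*" if "c \<in> ?T" for c
    using that
  proof (induction "nat (fst c + snd c)" arbitrary: c rule: less_induct)
    case less
    obtain x y where c: "c = (x, y)"
      by fastforce
    consider "y > 0" | "y = 0" "x > 0" | "y = 0" "x = 0"
      using less.prems by (force simp: c truncated_triangle_def)
    then show ?case
    proof cases
      case 1
      have "(c, (x, y - 1)) \<in> ?E" "((x, y - 1), (0, 0)) \<in> ?E\<^sup>*"
        using less 1 by (auto simp: c truncated_triangle_def edge_adjacent_def)
      then show ?thesis
        by (rule converse_rtrancl_into_rtrancl)
    next
      case 2
      have "(c, (x - 1, y)) \<in> ?E" "((x - 1, y), (0, 0)) \<in> ?E\<^sup>*"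
        using less 2 by (auto simp: c truncated_triangle_def edge_adjacent_def)
      then show ?thesis
        by (rule converse_rtrancl_into_rtrancl)
    qed (simp add: c)
  qed
  \<comment> \<open>Reversed paths join any two cells through the origin.\<close>
  have "sym ?E"
    by (auto simp: sym_def edge_adjacent_def abs_minus_commute)
  then have "sym (?E\<^sup>*)"
    by (rule sym_rtrancl)
  then have "edge_connected ?T"
    unfolding edge_connected_def using to_origin by (meson rtrancl_trans symD)
  \<comment> \<open>Both follow from the cardinality 35, as \<open>card\<close> is 0 on infinite
    sets and on the empty set.\<close>
  moreover have "finite ?T" "?T \<noteq> {}"
    using card_truncated_triangle by (auto intro: card_ge_0_finite)
  ultimately show ?thesis
    by (simp add: polyomino_def)
qed

theorem theorem7p6:
  fixes P :: "cell set"
  assumes "minimum_polyomino 27 L_tromino P"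
  shows "34 \<le> card P \<and> card P \<le> 35"
proof
  show "34 \<le> card P"
    using assms
    by (intro card_ge_34)
      (simp_all add: minimum_polyomino_def polyomino_def contains_instances_def
        card_instances_in_L_tromino)
  have "contains_instances 27 L_tromino truncated_triangle"
    by (simp add: contains_instances_def card_instances_in_L_tromino
        card_corners_truncated_triangle)
  then have "card P \<le> card truncated_triangle"
    using assms polyomino_truncated_triangle by (simp add: minimum_polyomino_def)
  then show "card P \<le> 35"
    by (simp only: card_truncated_triangle)
qed

end
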